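(* Let $\mathcal P_1$ and $\mathcal P_2$ be two finite posets such that at least one of them has the UCTP and has at least two elements. Then $\text{sat}^*(n,\mathcal P_2*\mathcal P_1)\to\infty$ as $n\to\infty$.
   Context: A poset $\mathcal Q$ contains an induced copy of a poset $\mathcal P$ if there is an injective map $f:\mathcal P\to\mathcal Q$ with $f(x)\le f(y)$ iff $x\le y$. For a finite poset $\mathcal P$, a family $\mathcal F$ of subsets of $[n]$ (ordered by inclusion) is $\mathcal P$-saturated if $\mathcal F$ contains no induced copy of $\mathcal P$ but for every $S\subseteq[n]$ with $S\notin\mathcal F$, $\mathcal F\cup\{S\}$ contains an induced copy of $\mathcal P$; $\text{sat}^*(n,\mathcal P)$ is the minimum size of a $\mathcal P$-saturated family of subsets of $[n]$. For finite posets $\mathcal P_1,\mathcal P_2$, $\mathcal P_2*\mathcal P_1$ is the poset on the disjoint union of $\mathcal P_1$ and $\mathcal P_2$, keeping the orders within each, with every element of $\mathcal P_1$ strictly below every element of $\mathcal P_2$. In a poset, $y$ covers $x$ if $x<y$ and there is no $z$ with $x<z<y$. A poset has the unique cover twin property (UCTP) if whenever $p_2$ covers $p_1$, there exists an element $p_3$ comparable with exactly one of $p_1,p_2$. *)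

theory Defs
  imports Complex_Main
begin

text \<open>
  A poset is a relation \<open>P\<close> with \<open>Partial_order P\<close>; its ground set is \<open>Field P\<close>, and
  \<open>(x, y) \<in> P\<close> means \<open>x \<le> y\<close>.
\<close>

definition induced_copy :: "'a rel \<Rightarrow> 'b rel \<Rightarrow> bool" where
  "induced_copy P Q \<longleftrightarrow>
     (\<exists>f. inj_on f (Field P) \<and> f ` Field P \<subseteq> Field Q \<and>
          (\<forall>x\<in>Field P. \<forall>y\<in>Field P. (f x, f y) \<in> Q \<longleftrightarrow> (x, y) \<in> P))"

definition incl :: "'a set set \<Rightarrow> 'a set rel" where
  "incl F = {(X, Y). X \<in> F \<and> Y \<in> F \<and> X \<subseteq> Y}"

definition saturated :: "nat \<Rightarrow> 'a rel \<Rightarrow> nat set set \<Rightarrow> bool" where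
  "saturated n P F \<longleftrightarrow>
     F \<subseteq> Pow {1..n} \<and> \<not> induced_copy P (incl F) \<and>
     (\<forall>S. S \<subseteq> {1..n} \<and> S \<notin> F \<longrightarrow> induced_copy P (incl (insert S F)))"

definition sat_star :: "nat \<Rightarrow> 'a rel \<Rightarrow> nat" where
  "sat_star n P = Min (card ` {F. saturated n P F})"

text \<open>
  The poset \<open>P\<^sub>2 * P\<^sub>1\<close>: the upper summand is the first argument. Tagging with \<open>Inl\<close> and
  \<open>Inr\<close> makes the two ground sets disjoint.
\<close>

definition poset_star :: "'b rel \<Rightarrow> 'a rel \<Rightarrow> ('a + 'b) rel" where
  "poset_star P2 P1 =
     map_prod Inl Inl ` P1 \<union> map_prod Inr Inr ` P2 \<union> (Inl ` Field P1) \<times> (Inr ` Field P2)"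

definition covers :: "'a rel \<Rightarrow> 'a \<Rightarrow> 'a \<Rightarrow> bool" where
  "covers P y x \<longleftrightarrow>
     (x, y) \<in> P \<and> x \<noteq> y \<and>
     \<not> (\<exists>z. (x, z) \<in> P \<and> x \<noteq> z \<and> (z, y) \<in> P \<and> z \<noteq> y)"

definition comparable :: "'a rel \<Rightarrow> 'a \<Rightarrow> 'a \<Rightarrow> bool" where
  "comparable P x y \<longleftrightarrow> (x, y) \<in> P \<or> (y, x) \<in> P"

text \<open>
  Comparability is reflexive, so the witness \<open>p3\<close> is automatically different from \<open>p1\<close> and \<open>p2\<close>.
\<close>

definition UCTP :: "'a rel \<Rightarrow> bool" where
  "UCTP P \<longleftrightarrow>
     (\<forall>p1\<in>Field P. \<forall>p2\<in>Field P. covers P p2 p1 \<longrightarrow>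
        (\<exists>p3\<in>Field P. comparable P p3 p1 \<noteq> comparable P p3 p2))"

lemma Field_incl [simp]: "Field (incl F) = F"
  by (auto simp: incl_def Field_def)

lemma poset_star_iff:
  "(Inl x, Inl y) \<in> poset_star P2 P1 \<longleftrightarrow> (x, y) \<in> P1"
  "(Inr u, Inr v) \<in> poset_star P2 P1 \<longleftrightarrow> (u, v) \<in> P2"
  "(Inl x, Inr v) \<in> poset_star P2 P1 \<longleftrightarrow> x \<in> Field P1 \<and> v \<in> Field P2"
  "(Inr u, Inl y) \<notin> poset_star P2 P1"
  by (auto simp: poset_star_def)

lemma Partial_order_poset_star:
  assumes "Partial_order P1" "Partial_order P2"
  shows "Partial_order (poset_star P2 P1)" "Field (poset_star P2 P1) = Inl ` Field P1 \<union> Inr ` Field P2"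
proof -
  have r: "(x, x) \<in> P1" if "x \<in> Field P1" for x
    using assms(1) that by (simp add: partial_order_on_def preorder_on_def refl_on_def)
  have r': "(x, x) \<in> P2" if "x \<in> Field P2" for x
    using assms(2) that by (simp add: partial_order_on_def preorder_on_def refl_on_def)
  have a: "trans P1" "antisym P1" "trans P2" "antisym P2"
    using assms by (simp_all add: partial_order_on_def preorder_on_def)
  have sub: "poset_star P2 P1 \<subseteq> (Inl ` Field P1 \<union> Inr ` Field P2) \<times> (Inl ` Field P1 \<union> Inr ` Field P2)"
    by (auto simp: poset_star_def intro: FieldI1 FieldI2)
  have refl: "(x, x) \<in> poset_star P2 P1" if "x \<in> Inl ` Field P1 \<union> Inr ` Field P2" for x
    using that by (auto simp: poset_star_iff r r')
  show F: "Field (poset_star P2 P1) = Inl ` Field P1 \<union> Inr ` Field P2"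
  proof
    show "Field (poset_star P2 P1) \<subseteq> Inl ` Field P1 \<union> Inr ` Field P2"
      using sub unfolding Field_def by blast
    show "Inl ` Field P1 \<union> Inr ` Field P2 \<subseteq> Field (poset_star P2 P1)"
      using refl FieldI1 by (metis subsetI)
  qed
  have "trans (poset_star P2 P1)"
  proof (rule transI)
    fix x y z assume "(x, y) \<in> poset_star P2 P1" "(y, z) \<in> poset_star P2 P1"
    then show "(x, z) \<in> poset_star P2 P1"
      by (cases x; cases y; cases z; simp add: poset_star_iff)
        (blast intro: FieldI1 FieldI2 transD[OF a(1)] transD[OF a(3)])+
  qed
  moreover have "antisym (poset_star P2 P1)"
  proof (rule antisymI)
    fix x y assume "(x, y) \<in> poset_star P2 P1" "(y, x) \<in> poset_star P2 P1"
    then show "x = y"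
      by (cases x; cases y; simp add: poset_star_iff) (blast intro: antisymD[OF a(2)] antisymD[OF a(4)])+
  qed
  ultimately show "Partial_order (poset_star P2 P1)"
    using sub refl by (simp add: partial_order_on_def preorder_on_def refl_on_def F)
qed

text \<open>
  For nonempty \<open>P\<close> the minimum in the definition of \<open>sat_star\<close> is taken over a finite nonempty set.
\<close>

lemma finite_saturated: "finite {F. saturated n P F}"
  by (rule finite_subset[of _ "Pow (Pow {1..n})"]) (auto simp: saturated_def)

lemma saturated_exists:
  assumes "Field P \<noteq> {}"
  shows "\<exists>F. saturated n P F"
proof -
  let ?A = "{F. F \<subseteq> Pow {1..n} \<and> \<not> induced_copy P (incl F)}"
  have "finite ?A"
    by (rule finite_subset[of _ "Pow (Pow {1..n})"]) auto
  moreover have "{} \<in> ?A"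
    using assms by (auto simp: induced_copy_def)
  ultimately have "\<exists>F\<in>?A. \<forall>G\<in>?A. F \<subseteq> G \<longrightarrow> F = G"
    by (intro finite_has_maximal) (assumption, rule notI, simp only: empty_iff)
  then obtain F where F: "F \<in> ?A" and max: "\<forall>G\<in>?A. F \<subseteq> G \<longrightarrow> F = G"
    by (rule bexE)
  have "saturated n P F"
    unfolding saturated_def
  proof (intro conjI allI impI)
    fix S assume S: "S \<subseteq> {1..n} \<and> S \<notin> F"
    show "induced_copy P (incl (insert S F))"
    proof (rule ccontr)
      assume "\<not> induced_copy P (incl (insert S F))"
      then have "insert S F \<in> ?A" using F S by simp
      then have "F \<subseteq> insert S F \<longrightarrow> F = insert S F" by (rule bspec[OF max])
      then have "F = insert S F" using subset_insertI by (rule mp)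
      then show False using S by (metis insertI1)
    qed
  qed (use F in simp_all)
  then show ?thesis ..
qed

end

theory Submission imports Defs
begin

text \<open>
  If \<open>n > 2 ^ card F\<close>, some \<open>i \<noteq> j\<close> lie in exactly the same members of the saturated family \<open>F\<close>.
  By complementation we may assume that \<open>P1\<close> has the UCTP and at least two elements.
  Whenever a set \<open>Y \<notin> F\<close> lies strictly below a copy of \<open>P2\<close> in \<open>F\<close>, every copy of \<open>P2 * P1\<close>
  created by \<open>Y\<close> uses \<open>Y\<close> in its \<open>P1\<close> part, since otherwise its \<open>P1\<close> part together with the given
  copy of \<open>P2\<close> would already lie in \<open>F\<close>. If some member of \<open>F\<close> that lies below a copy of \<open>P2\<close>
  contains \<open>i\<close>, take a minimal such set \<open>M\<close> and add \<open>M - {j}\<close>; if not, take a set \<open>A\<close> that is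
  maximal among the members \<open>X\<close> of \<open>F\<close> for which \<open>insert i X\<close> lies below a copy of \<open>P2\<close>, and add
  \<open>insert i A\<close>. In both cases the added set and the set it comes from compare in the same way to
  the rest of the new \<open>P1\<close> part, so the UCTP prevents that part from containing both, and exchanging
  them yields a copy of \<open>P2 * P1\<close> inside \<open>F\<close>.
\<close>

section \<open>Order embeddings into families of sets\<close>

text \<open>Stated with plain inclusion of the values; injectivity then follows from antisymmetry of
  \<open>P\<close>.\<close>

definition embeds :: "'a rel \<Rightarrow> 'b set set \<Rightarrow> ('a \<Rightarrow> 'b set) \<Rightarrow> bool" where
  "embeds P F f \<longleftrightarrow>
     f ` Field P \<subseteq> F \<and> (\<forall>x\<in>Field P. \<forall>y\<in>Field P. f x \<subseteq> f y \<longleftrightarrow> (x, y) \<in> P)"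

lemma embeds_in: "embeds P F f \<Longrightarrow> x \<in> Field P \<Longrightarrow> f x \<in> F"
  by (auto simp: embeds_def)

lemma embeds_iff:
  "embeds P F f \<Longrightarrow> x \<in> Field P \<Longrightarrow> y \<in> Field P \<Longrightarrow> f x \<subseteq> f y \<longleftrightarrow> (x, y) \<in> P"
  by (auto simp: embeds_def)

lemma embeds_inj:
  assumes "Partial_order P" "embeds P F f"
  shows "inj_on f (Field P)"
proof (rule inj_onI)
  fix x y assume "x \<in> Field P" "y \<in> Field P" "f x = f y"
  then have "(x, y) \<in> P" "(y, x) \<in> P"
    using embeds_iff[OF assms(2)] by auto
  then show "x = y"
    using assms(1) by (auto simp: partial_order_on_def antisym_def)
qed

lemma embeds_restrict:
  assumes "embeds P (insert Y F) f" "\<And>x. x \<in> Field P \<Longrightarrow> f x \<noteq> Y"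
  shows "embeds P F f"
  using assms by (auto simp: embeds_def)

lemma induced_copy_incl_iff:
  assumes "Partial_order P"
  shows "induced_copy P (incl F) \<longleftrightarrow> (\<exists>f. embeds P F f)"
proof -
  have "embeds P F f \<longleftrightarrow> inj_on f (Field P) \<and> f ` Field P \<subseteq> Field (incl F) \<and>
      (\<forall>x\<in>Field P. \<forall>y\<in>Field P. (f x, f y) \<in> incl F \<longleftrightarrow> (x, y) \<in> P)" for f
    unfolding Field_incl using embeds_inj[OF assms, of F f]
    by (simp add: embeds_def incl_def image_subset_iff) blast
  then show ?thesis
    by (simp add: induced_copy_def)
qed

text \<open>Strict inclusion encodes both cross relations of the sum at once: lower below upper, and
  never the converse.\<close>

lemma induced_copy_poset_star_iff:
  assumes "Partial_order P1" "Partial_order P2"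
  shows "induced_copy (poset_star P2 P1) (incl F) \<longleftrightarrow>
    (\<exists>f g. embeds P1 F f \<and> embeds P2 F g \<and> (\<forall>x\<in>Field P1. \<forall>y\<in>Field P2. f x \<subset> g y))"
    (is "_ \<longleftrightarrow> ?R")
proof -
  note star = Partial_order_poset_star[OF assms]
  have "(\<exists>h. embeds (poset_star P2 P1) F h) \<longleftrightarrow> ?R"
  proof
    assume "\<exists>h. embeds (poset_star P2 P1) F h"
    then obtain h where h: "embeds (poset_star P2 P1) F h" ..
    have "embeds P1 F (h \<circ> Inl)" "embeds P2 F (h \<circ> Inr)"
      using h by (auto simp: embeds_def star(2) poset_star_iff)
    moreover have "(h \<circ> Inl) x \<subset> (h \<circ> Inr) y" if "x \<in> Field P1" "y \<in> Field P2" for x y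
    proof -
      have "h (Inl x) \<subseteq> h (Inr y)" "\<not> h (Inr y) \<subseteq> h (Inl x)"
        using that by (simp_all add: embeds_iff[OF h] star(2) poset_star_iff)
      then show ?thesis by auto
    qed
    ultimately show ?R by blast
  next
    assume ?R
    then obtain f g where fg: "embeds P1 F f" "embeds P2 F g"
      "\<And>x y. x \<in> Field P1 \<Longrightarrow> y \<in> Field P2 \<Longrightarrow> f x \<subset> g y"
      by blast
    have "f x \<subseteq> g y" "\<not> g y \<subseteq> f x" if "x \<in> Field P1" "y \<in> Field P2" for x y
      using fg(3)[OF that] by auto
    then have "embeds (poset_star P2 P1) F (case_sum f g)"
      using fg(1,2) unfolding embeds_def star(2)
      by (simp add: poset_star_iff ball_Un image_subset_iff image_Un)
    then show "\<exists>h. embeds (poset_star P2 P1) F h" by blast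
  qed
  then show ?thesis
    by (simp add: induced_copy_incl_iff[OF star(1)])
qed

text \<open>The exchange step: the UCTP rules out that \<open>W\<close> is already in the image of \<open>f\<close>.\<close>

lemma embeds_exchange:
  assumes po: "Partial_order P" and uctp: "UCTP P"
    and f: "embeds P (insert Y F) f" and x0: "x0 \<in> Field P" "f x0 = Y"
    and W: "W \<in> F" and near: "W = insert a Y \<or> Y = insert a W" and "Y \<noteq> W"
    and same: "\<And>Z. Z \<in> f ` Field P \<Longrightarrow> Z \<noteq> Y \<Longrightarrow> Z \<noteq> W \<Longrightarrow>
      (Z \<subseteq> Y \<longleftrightarrow> Z \<subseteq> W) \<and> (Y \<subseteq> Z \<longleftrightarrow> W \<subseteq> Z)"
  shows "embeds P F (f(x0 := W))"
proof -
  have inj: "f x = f y \<longleftrightarrow> x = y" if "x \<in> Field P" "y \<in> Field P" for x y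
    using embeds_inj[OF po f] that by (auto simp: inj_on_def)
  \<comment> \<open>No set lies strictly between two sets that differ in the single element
    \<open>a\<close>.\<close>
  have cov: "covers P q p" if pq: "p \<in> Field P" "q \<in> Field P" "f q = insert a (f p)" "p \<noteq> q" for p q
    unfolding covers_def
  proof (intro conjI notI)
    show "(p, q) \<in> P"
      using pq embeds_iff[OF f, of p q] by auto
    assume "\<exists>z. (p, z) \<in> P \<and> p \<noteq> z \<and> (z, q) \<in> P \<and> z \<noteq> q"
    then obtain z where z: "(p, z) \<in> P" "p \<noteq> z" "(z, q) \<in> P" "z \<noteq> q" by blast
    then have "z \<in> Field P" by (auto simp: Field_def)
    then have "f p \<subseteq> f z" "f z \<subseteq> f q" "f p \<noteq> f z" "f z \<noteq> f q"
      by (simp_all add: z pq(1,2) inj embeds_iff[OF f])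
    then show False unfolding pq(3) by blast
  qed (use pq in auto)
  have notin: "f w \<noteq> W" if w: "w \<in> Field P" for w
  proof
    assume fw: "f w = W"
    then have "w \<noteq> x0" using x0 \<open>Y \<noteq> W\<close> by auto
    then have "covers P w x0 \<or> covers P x0 w"
      using near cov[of x0 w] cov[of w x0] w x0 fw by auto
    then obtain z where z: "z \<in> Field P" "comparable P z w \<noteq> comparable P z x0"
      using uctp w x0(1) unfolding UCTP_def by metis
    have comp: "comparable P x y \<longleftrightarrow> f x \<subseteq> f y \<or> f y \<subseteq> f x"
      if "x \<in> Field P" "y \<in> Field P" for x y
      using that by (simp add: comparable_def embeds_iff[OF f])
    \<comment> \<open>\<open>Y\<close> and \<open>W\<close> are nested, so either one is comparable
      with both; \<open>z\<close> is comparable with only one preimage.\<close>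
    have "f z \<noteq> Y" "f z \<noteq> W"
      using z(2) near x0 fw by (auto simp: comp z(1) w)
    then show False
      using z(2) same[of "f z"] by (auto simp: comp z(1) w x0 fw)
  qed
  have rest: "f x \<in> F \<and> (f x \<subseteq> W \<longleftrightarrow> (x, x0) \<in> P) \<and> (W \<subseteq> f x \<longleftrightarrow> (x0, x) \<in> P)"
    if x: "x \<in> Field P" "x \<noteq> x0" for x
  proof -
    have "f x \<noteq> Y" using inj[of x x0] x x0 by auto
    then have "f x \<in> F" "f x \<subseteq> W \<longleftrightarrow> f x \<subseteq> Y" "W \<subseteq> f x \<longleftrightarrow> Y \<subseteq> f x"
      using embeds_in[OF f x(1)] same[of "f x"] notin[OF x(1)] x by auto
    then show ?thesis
      using embeds_iff[OF f x(1) x0(1)] embeds_iff[OF f x0(1) x(1)] x0(2) by simp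
  qed
  have "(x0, x0) \<in> P"
    using embeds_iff[OF f x0(1) x0(1)] by simp
  then show ?thesis
    using rest W embeds_iff[OF f] unfolding embeds_def by auto
qed

section \<open>Separation of points by a saturated family\<close>

text \<open>The new copy has to use \<open>Y\<close>, and not in both halves, because lower values
  are strictly below upper ones. So the other half lies in \<open>F\<close>. Case
  \<open>upper\<close> is contradictory once \<open>Y\<close> lies below some copy of
  \<open>P2\<close> in \<open>F\<close>.\<close>

lemma saturated_new_copy:
  assumes po: "Partial_order P1" "Partial_order P2"
    and sat: "saturated n (poset_star P2 P1) F" and Y: "Y \<subseteq> {1..n}" "Y \<notin> F"
  obtains
    (lower) f g x0 where "embeds P1 (insert Y F) f" "embeds P2 F g" "x0 \<in> Field P1" "f x0 = Y"
      "\<And>x y. x \<in> Field P1 \<Longrightarrow> y \<in> Field P2 \<Longrightarrow> f x \<subset> g y"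
  | (upper) f where "embeds P1 F f" "\<And>x. x \<in> Field P1 \<Longrightarrow> f x \<subset> Y"
proof -
  obtain f g where f: "embeds P1 (insert Y F) f" and g: "embeds P2 (insert Y F) g"
    and fg: "\<And>x y. x \<in> Field P1 \<Longrightarrow> y \<in> Field P2 \<Longrightarrow> f x \<subset> g y"
    using sat Y induced_copy_poset_star_iff[OF po, of "insert Y F"]
    unfolding saturated_def by metis
  consider (a) x0 where "x0 \<in> Field P1" "f x0 = Y" | (b) y0 where "y0 \<in> Field P2" "g y0 = Y"
    | (c) "\<And>x. x \<in> Field P1 \<Longrightarrow> f x \<noteq> Y" "\<And>y. y \<in> Field P2 \<Longrightarrow> g y \<noteq> Y"
    by blast
  then show thesis
  proof cases
    case a
    then have "embeds P2 F g"
      using fg by (intro embeds_restrict[OF g]) auto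
    then show thesis using lower f a fg by blast
  next
    case b
    then have "embeds P1 F f"
      using fg by (intro embeds_restrict[OF f]) auto
    then show thesis using upper fg b by blast
  next
    case c
    then have "induced_copy (poset_star P2 P1) (incl F)"
      using embeds_restrict[OF f] embeds_restrict[OF g] fg
      unfolding induced_copy_poset_star_iff[OF po] by blast
    then show thesis using sat by (simp add: saturated_def)
  qed
qed

lemma saturated_separates:
  assumes po: "Partial_order P1" "Partial_order P2"
    and uctp: "UCTP P1" and two: "card (Field P1) \<ge> 2"
    and sat: "saturated n (poset_star P2 P1) F"
    and ij: "i \<in> {1..n}" "i \<noteq> j" and twins: "\<And>X. X \<in> F \<Longrightarrow> i \<in> X \<longleftrightarrow> j \<in> X"
  shows False
proof -
  have no_copy: False if "embeds P1 F f" "embeds P2 F g"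
    "\<And>x y. x \<in> Field P1 \<Longrightarrow> y \<in> Field P2 \<Longrightarrow> f x \<subset> g y" for f g
  proof -
    have "induced_copy (poset_star P2 P1) (incl F)"
      unfolding induced_copy_poset_star_iff[OF po] using that by (intro exI conjI ballI)
    then show False using sat by (simp add: saturated_def)
  qed
  have sub: "X \<subseteq> {1..n}" if "X \<in> F" for X
    using sat that by (auto simp: saturated_def)
  then have "finite F"
    using finite_subset[of F "Pow {1..n}"] by auto
  \<comment> \<open>For \<open>i \<in> X\<close> the condition just says that \<open>X\<close> lies
    strictly below a copy of \<open>P2\<close>, so one set \<open>E\<close> serves both
    cases.\<close>
  define E where
    "E = {X \<in> F. \<exists>g. embeds P2 F g \<and> (\<forall>y\<in>Field P2. insert i X \<subset> g y)}"
  \<comment> \<open>The set \<open>{i}\<close> is added. If it lands in the lower half, a second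
    element of \<open>P1\<close> gives a member of \<open>E\<close>: each \<open>g y\<close>
    contains \<open>i\<close>, hence \<open>j\<close>, and this keeps the inclusion strict.
    Otherwise all of \<open>P1\<close> would map to the empty set.\<close>
  have "E \<noteq> {}"
  proof -
    have Y: "{i} \<subseteq> {1..n}" "{i} \<notin> F"
      using ij twins[of "{i}"] by auto
    from po sat Y show ?thesis
    proof (cases rule: saturated_new_copy)
      case (lower f g x0)
      obtain x1 where x1: "x1 \<in> Field P1" "x1 \<noteq> x0"
        using two lower(3) by (metis card_le_Suc0_iff_eq card.infinite not_less_eq_eq
            numeral_2_eq_2 zero_le)
      have "f x1 \<noteq> {i}"
        using embeds_inj[OF po(1) lower(1)] x1 lower(3,4) by (auto simp: inj_on_def)
      then have "f x1 \<in> F"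
        using embeds_in[OF lower(1) x1(1)] by auto
      moreover have "insert i (f x1) \<subset> g y" if "y \<in> Field P2" for y
      proof -
        have "i \<in> g y" "f x1 \<subset> g y"
          using lower(5)[OF lower(3) that] lower(5)[OF x1(1) that] lower(4) by auto
        moreover have "j \<in> g y" "f x1 \<in> F"
          using \<open>i \<in> g y\<close> twins embeds_in[OF lower(2) that] \<open>f x1 \<in> F\<close> by auto
        ultimately show ?thesis
          using twins[of "f x1"] ij(2) by (cases "i \<in> f x1") auto
      qed
      ultimately have "f x1 \<in> E"
        using lower(2) unfolding E_def by blast
      then show ?thesis by blast
    next
      case (upper f)
      then have "f ` Field P1 \<subseteq> {{}}" by blast
      then have "card (f ` Field P1) \<le> 1"
        using card_mono[of "{{}}" "f ` Field P1"] by simp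
      then show ?thesis
        using two card_image[OF embeds_inj[OF po(1) upper(1)]] by simp
    qed
  qed
  show False
  proof (cases "\<exists>X\<in>E. i \<in> X")
    case True
    then obtain X g0 where X: "X \<in> F" "i \<in> X" and g0: "embeds P2 F g0"
      and Xg0: "\<And>y. y \<in> Field P2 \<Longrightarrow> X \<subset> g0 y"
      unfolding E_def by (auto simp: insert_absorb)
    have "finite {Z \<in> F. i \<in> Z \<and> Z \<subseteq> X}" "{Z \<in> F. i \<in> Z \<and> Z \<subseteq> X} \<noteq> {}"
      using \<open>finite F\<close> X by auto
    from finite_has_minimal[OF this] obtain M where M: "M \<in> F" "i \<in> M" "M \<subseteq> X"
      and min: "\<And>Z. Z \<in> F \<Longrightarrow> i \<in> Z \<Longrightarrow> Z \<subseteq> M \<Longrightarrow> Z = M"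
      by (smt (verit) mem_Collect_eq order_trans)
    have Mg0: "M \<subset> g0 y" if "y \<in> Field P2" for y
      using M(3) Xg0[OF that] by auto
    have j: "j \<in> M" using twins M by auto
    let ?Y = "M - {j}"
    have Y: "?Y \<subseteq> {1..n}" "?Y \<notin> F"
      using sub[OF M(1)] M ij(2) twins[of ?Y] by auto
    from po sat Y show False
    proof (cases rule: saturated_new_copy)
      case (lower f g x0)
      have f': "embeds P1 F (f(x0 := M))"
      proof (rule embeds_exchange[OF po(1) uctp lower(1,3,4) M(1), of j])
        fix Z assume "Z \<in> f ` Field P1" "Z \<noteq> ?Y" "Z \<noteq> M"
        then have "Z \<in> F" using embeds_in[OF lower(1)] by auto
        \<comment> \<open>If \<open>Z\<close> is properly inside \<open>M\<close>, minimality
          excludes \<open>i\<close>, hence \<open>j\<close>; if \<open>Z\<close> contains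
          \<open>?Y\<close>, it contains \<open>i\<close>, hence \<open>j\<close>.\<close>
        then show "(Z \<subseteq> ?Y \<longleftrightarrow> Z \<subseteq> M) \<and> (?Y \<subseteq> Z \<longleftrightarrow> M \<subseteq> Z)"
          using twins[of Z] min[of Z] M(2) ij(2) \<open>Z \<noteq> M\<close> by blast
      qed (use j in auto)
      have Mg: "M \<subseteq> g y" if "y \<in> Field P2" for y
      proof -
        have "?Y \<subseteq> g y" using lower(5)[OF lower(3) that] lower(4) by auto
        moreover have "j \<in> g y"
          using calculation twins embeds_in[OF lower(2) that] M(2) ij(2) by blast
        ultimately show ?thesis by auto
      qed
      show False
      \<comment> \<open>If the upper half itself uses \<open>M\<close>, the exchange breaks
        strictness; but then the whole lower half was below \<open>M\<close>, and \<open>g0\<close>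
        can replace \<open>g\<close>.\<close>
      proof (cases "\<exists>y\<in>Field P2. g y = M")
        case True
        then have "f x \<subset> M" if "x \<in> Field P1" for x
          using lower(5)[OF that] by auto
        then show False
          using Mg0 by (intro no_copy[OF f' g0]) (auto split: if_splits, blast+)
      next
        case False
        then have "(f(x0 := M)) x \<subset> g y" if "x \<in> Field P1" "y \<in> Field P2" for x y
          using lower(5)[OF that] Mg[OF that(2)] that by auto
        then show False
          by (rule no_copy[OF f' lower(2)])
      qed
    next
      case (upper f)
      then show False
        using Mg0 by (intro no_copy[OF upper(1) g0]) blast
    qed
  next
    case False
    have "finite E" using \<open>finite F\<close> by (auto simp: E_def)
    from finite_has_maximal[OF this \<open>E \<noteq> {}\<close>] obtain A where A: "A \<in> E"
      and max: "\<And>Z. Z \<in> E \<Longrightarrow> A \<subseteq> Z \<Longrightarrow> A = Z"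
      by blast
    have "A \<in> F" "i \<notin> A"
      using A False unfolding E_def by blast+
    then have AF: "A \<in> F" "i \<notin> A" "j \<notin> A"
      using twins[of A] by auto
    obtain g0 where g0: "embeds P2 F g0" "\<And>y. y \<in> Field P2 \<Longrightarrow> insert i A \<subset> g0 y"
      using A by (auto simp: E_def)
    let ?Y = "insert i A"
    have Y: "?Y \<subseteq> {1..n}" "?Y \<notin> F"
      using sub[OF AF(1)] AF ij twins[of ?Y] by auto
    from po sat Y show False
    proof (cases rule: saturated_new_copy)
      case (lower f g x0)
      have f': "embeds P1 F (f(x0 := A))"
      proof (rule embeds_exchange[OF po(1) uctp lower(1,3,4) AF(1), of i])
        fix Z assume Z: "Z \<in> f ` Field P1" "Z \<noteq> ?Y" "Z \<noteq> A"
        then have "Z \<in> F" using embeds_in[OF lower(1)] by auto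
        \<comment> \<open>Otherwise \<open>Z\<close> would be a member of \<open>E\<close> properly
          containing \<open>A\<close>.\<close>
        have "i \<in> Z" if "A \<subseteq> Z"
        proof (rule ccontr)
          assume "i \<notin> Z"
          have "insert i Z \<subset> g y" if y: "y \<in> Field P2" for y
          proof -
            have "i \<in> g y"
              using lower(5)[OF lower(3) y] lower(4) by auto
            moreover have "Z \<subset> g y"
              using lower(5) y Z(1) by blast
            moreover have "j \<in> g y" "j \<notin> Z"
              using \<open>i \<in> g y\<close> \<open>i \<notin> Z\<close> \<open>Z \<in> F\<close> twins embeds_in[OF lower(2) y] by auto
            ultimately show ?thesis using ij(2) by auto
          qed
          then have "Z \<in> E" using \<open>Z \<in> F\<close> lower(2) unfolding E_def by blast
          then show False using max that Z(3) by auto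
        qed
        \<comment> \<open>A member of \<open>F\<close> inside \<open>?Y\<close> omits
          \<open>j\<close>, hence also \<open>i\<close>.\<close>
        then show "(Z \<subseteq> ?Y \<longleftrightarrow> Z \<subseteq> A) \<and> (?Y \<subseteq> Z \<longleftrightarrow> A \<subseteq> Z)"
          using twins[OF \<open>Z \<in> F\<close>] AF ij(2) by blast
      qed (use AF in auto)
      have "(f(x0 := A)) x \<subset> g y" if "x \<in> Field P1" "y \<in> Field P2" for x y
        using lower(5)[OF that] lower(5)[OF lower(3) that(2)] lower(4) by auto
      then show False
        by (rule no_copy[OF f' lower(2)])
    next
      case (upper f)
      then show False
        using g0(2) by (intro no_copy[OF upper(1) g0(1)]) blast
    qed
  qed
qed

section \<open>The logarithmic lower bound\<close>

text \<open>By separation, a point of \<open>{1..n}\<close> is determined by the members of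
  \<open>F\<close> containing it, which form one of \<open>2 ^ card F\<close> subfamilies.\<close>

lemma saturated_card_ge:
  assumes "Partial_order P1" "Partial_order P2" "UCTP P1" "card (Field P1) \<ge> 2"
    and sat: "saturated n (poset_star P2 P1) F"
  shows "n \<le> 2 ^ card F"
proof (rule ccontr)
  assume "\<not> n \<le> 2 ^ card F"
  moreover have "finite F"
    using sat finite_subset[of F "Pow {1..n}"] by (auto simp: saturated_def)
  moreover have "(\<lambda>i. {X \<in> F. i \<in> X}) ` {1..n} \<subseteq> Pow F" by auto
  ultimately have "\<not> inj_on (\<lambda>i. {X \<in> F. i \<in> X}) {1..n}"
    using card_inj_on_le[of "\<lambda>i. {X \<in> F. i \<in> X}" "{1..n}" "Pow F"] by (auto simp: card_Pow)
  then obtain i j where "i \<in> {1..n}" "i \<noteq> j" "{X \<in> F. i \<in> X} = {X \<in> F. j \<in> X}"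
    unfolding inj_on_def by blast
  moreover from this have "i \<in> X \<longleftrightarrow> j \<in> X" if "X \<in> F" for X
    using that by blast
  ultimately show False
    using saturated_separates[OF assms(1-4) sat] by metis
qed

section \<open>Duality under complementation\<close>

lemma UCTP_converse: "UCTP P \<Longrightarrow> UCTP (P\<inverse>)"
proof -
  have "covers (P\<inverse>) x y = covers P y x" "comparable (P\<inverse>) x y = comparable P x y" for x y
    by (auto simp: covers_def comparable_def)
  then show "UCTP P \<Longrightarrow> UCTP (P\<inverse>)"
    unfolding UCTP_def by (metis Field_converse)
qed

lemma embeds_complement:
  assumes "F \<subseteq> Pow U" "embeds P F f"
  shows "embeds (P\<inverse>) ((-) U ` F) (\<lambda>x. U - f x)"
proof -
  have "f x \<subseteq> U" if "x \<in> Field P" for x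
    using assms embeds_in[OF assms(2) that] by auto
  then have "U - f x \<subseteq> U - f y \<longleftrightarrow> f y \<subseteq> f x" if "x \<in> Field P" "y \<in> Field P" for x y
    using that by blast
  then show ?thesis
    using embeds_in[OF assms(2)] embeds_iff[OF assms(2)] by (simp add: embeds_def image_subset_iff)
qed

text \<open>Complementation reverses inclusion, so both summands are reversed and trade
  places.\<close>

lemma induced_copy_poset_star_complement:
  assumes po: "Partial_order P1" "Partial_order P2" and F: "F \<subseteq> Pow U"
    and copy: "induced_copy (poset_star P2 P1) (incl F)"
  shows "induced_copy (poset_star (P1\<inverse>) (P2\<inverse>)) (incl ((-) U ` F))"
proof -
  obtain f g where f: "embeds P1 F f" and g: "embeds P2 F g"
    and fg: "\<forall>x\<in>Field P1. \<forall>y\<in>Field P2. f x \<subset> g y"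
    using copy induced_copy_poset_star_iff[OF po] by metis
  have "U - g y \<subset> U - f x" if "x \<in> Field P1" "y \<in> Field P2" for x y
    using fg that embeds_in[OF f that(1)] embeds_in[OF g that(2)] F by blast
  moreover have "Partial_order (P1\<inverse>)" "Partial_order (P2\<inverse>)"
    using po by simp_all
  ultimately show ?thesis
    using embeds_complement[OF F f] embeds_complement[OF F g]
    by (subst induced_copy_poset_star_iff) (assumption, assumption, simp, blast)
qed

text \<open>Reduces the case where \<open>P2\<close> has the UCTP to the one where the lower summand
  has it. Complementation is an involution on subsets of \<open>{1..n}\<close>, so copies transfer
  in both directions.\<close>

lemma saturated_complement:
  assumes po: "Partial_order P1" "Partial_order P2"
    and sat: "saturated n (poset_star P2 P1) F"
  shows "saturated n (poset_star (P1\<inverse>) (P2\<inverse>)) ((-) {1..n} ` F)"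
proof -
  let ?U = "{1..n}"
  have F: "F \<subseteq> Pow ?U" using sat by (auto simp: saturated_def)
  have invol: "(-) ?U ` ((-) ?U ` G) = G" if "G \<subseteq> Pow ?U" for G
    using that by (force simp: image_image double_diff)
  have po': "Partial_order (P2\<inverse>)" "Partial_order (P1\<inverse>)"
    using po by simp_all
  show ?thesis
    unfolding saturated_def
  proof (intro conjI allI impI)
    show "\<not> induced_copy (poset_star (P1\<inverse>) (P2\<inverse>)) (incl ((-) ?U ` F))"
      using induced_copy_poset_star_complement[OF po', of "(-) ?U ` F" ?U] sat invol[OF F]
      by (auto simp: saturated_def)
    fix S assume S: "S \<subseteq> ?U \<and> S \<notin> (-) ?U ` F"
    then have S': "?U - (?U - S) = S" by auto
    then have "?U - S \<notin> F" using S by (metis imageI)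
    then have "induced_copy (poset_star P2 P1) (incl (insert (?U - S) F))"
      using sat by (auto simp: saturated_def)
    then show "induced_copy (poset_star (P1\<inverse>) (P2\<inverse>)) (incl (insert S ((-) ?U ` F)))"
      using induced_copy_poset_star_complement[OF po, of "insert (?U - S) F" ?U] F S' by auto
  qed auto
qed

section \<open>Divergence of the saturation number\<close>

theorem theorem2p3:
  fixes P1 :: "'a rel" and P2 :: "'b rel"
  assumes "Partial_order P1" and "finite (Field P1)"
    and "Partial_order P2" and "finite (Field P2)"
    and "(UCTP P1 \<and> card (Field P1) \<ge> 2) \<or> (UCTP P2 \<and> card (Field P2) \<ge> 2)"
  shows "filterlim (\<lambda>n. sat_star n (poset_star P2 P1)) at_top at_top"
proof -
  have bound: "n \<le> 2 ^ card F" if sat: "saturated n (poset_star P2 P1) F" for n F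
  proof (cases "UCTP P1 \<and> card (Field P1) \<ge> 2")
    case True
    then show ?thesis
      using saturated_card_ge[OF assms(1,3) _ _ sat] by simp
  next
    case False
    have "F \<subseteq> Pow {1..n}" using sat by (auto simp: saturated_def)
    \<comment> \<open>Injectivity makes the bound for the complemented family a bound for
      \<open>F\<close>.\<close>
    then have "inj_on ((-) {1..n}) F" by (auto simp: inj_on_def)
    moreover have "n \<le> 2 ^ card ((-) {1..n} ` F)"
      using saturated_card_ge[OF _ _ _ _ saturated_complement[OF assms(1,3) sat]]
        assms False UCTP_converse[of P2] by simp
    ultimately show ?thesis
      by (simp add: card_image)
  qed
  \<comment> \<open>Guarantees that a saturated family exists, so that \<open>Min\<close> is taken
    over a nonempty set.\<close>
  have "Field (poset_star P2 P1) \<noteq> {}"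
    using assms(5) by (auto simp: Partial_order_poset_star(2)[OF assms(1,3)])
  note ex = saturated_exists[OF this]
  show ?thesis
    unfolding filterlim_at_top
  proof
    fix K
    show "\<forall>\<^sub>F n in at_top. K \<le> sat_star n (poset_star P2 P1)"
      \<comment> \<open>Beyond this threshold \<open>2 ^ K < n \<le> 2 ^ card F\<close> forces
        \<open>K < card F\<close>.\<close>
      using eventually_gt_at_top[of "2 ^ K"]
    proof eventually_elim
      case (elim n)
      have "K \<le> card F" if "saturated n (poset_star P2 P1) F" for F
      proof -
        have "(2::nat) ^ K < 2 ^ card F"
          using bound[OF that] elim by linarith
        then show ?thesis by simp
      qed
      then show ?case
        unfolding sat_star_def using ex
        by (intro Min.boundedI finite_imageI finite_saturated) auto
    qed
  qed
qed

end
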